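(* Let $m \equiv 0 \pmod{4}$ be a positive integer, and let $e$ be an integer with $2 \leq e \leq \lfloor m/2\rfloor$ and $\gcd(m,e)=2$. Let $\alpha$ be a generator of $\mathbb{F}_{2^m}^*$, let $\mathcal{C}_E$ be the binary cyclic code of length $2^m-1$ with generator polynomial $\operatorname{lcm}\big(\mathbb{M}_{\alpha}(x),\mathbb{M}_{\alpha^{1+2^e}}(x)\big)$, and let $\overline{\mathcal{C}_E}$ be its extended code, with coordinates indexed by $V=\{0,1,\dots,2^m-1\}$. Then the supports of the codewords of Hamming weight $8$ in $\overline{\mathcal{C}_E}$ form a $2$-$(2^m,8,\lambda)$ design on $V$ with $$\lambda=\frac{2^{4m-4}-27\cdot 2^{3m-4}+23\cdot 2^{2m-1}+261\cdot 2^{m-2}+403}{45}.$$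
   Context: $\mathbb{M}_{\beta}(x)$ denotes the minimal polynomial of $\beta\in\mathbb{F}_{2^m}$ over $\mathbb{F}_2$. A binary cyclic code of length $n$ with generator polynomial $g(x)$ is the ideal generated by $g(x)$ in $\mathbb{F}_2[x]/(x^n-1)$, identified with vectors in $\mathbb{F}_2^n$. The extended code is obtained by appending an overall parity-check coordinate (sum of all coordinates) to each codeword. The support of a codeword is the set of coordinates where it is nonzero. A $2$-$(v,k,\lambda)$ design is a pair $(V,\mathcal{B})$ with $|V|=v$ and $\mathcal{B}$ a set of $k$-subsets of $V$ such that every $2$-subset of $V$ is contained in exactly $\lambda$ members of $\mathcal{B}$. *)

theory Defs
  imports
    Complex_Main
    "HOL-Library.Z2"
    "HOL-Library.Cardinality"
    "HOL-Number_Theory.Cong"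
    "HOL-Computational_Algebra.Computational_Algebra"
    "HOL-Computational_Algebra.Field_as_Ring"
begin

text \<open>
  The field with two elements is the type \<^typ>\<open>bit\<close>. The following instances, set up as for the
  other fields in \<^theory>\<open>HOL-Computational_Algebra.Field_as_Ring\<close>, are what makes the library's
  \<^const>\<open>lcm\<close> (normalised to be monic) available on \<^typ>\<open>bit poly\<close>.
\<close>

instantiation bit ::
  "{unique_euclidean_ring, normalization_euclidean_semiring, normalization_semidom_multiplicative}"
begin

definition [simp]: "normalize_bit = (normalize_field :: bit \<Rightarrow> _)"
definition [simp]: "unit_factor_bit = (unit_factor_field :: bit \<Rightarrow> _)"
definition [simp]: "euclidean_size_bit = (euclidean_size_field :: bit \<Rightarrow> _)"
definition [simp]: "division_segment (x :: bit) = 1"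

instance
  by standard
    (simp_all add: dvd_field_iff field_split_simps split: if_splits)

end

instantiation bit :: euclidean_ring_gcd
begin

definition gcd_bit :: "bit \<Rightarrow> bit \<Rightarrow> bit" where
  "gcd_bit = Euclidean_Algorithm.gcd"
definition lcm_bit :: "bit \<Rightarrow> bit \<Rightarrow> bit" where
  "lcm_bit = Euclidean_Algorithm.lcm"
definition Gcd_bit :: "bit set \<Rightarrow> bit" where
  "Gcd_bit = Euclidean_Algorithm.Gcd"
definition Lcm_bit :: "bit set \<Rightarrow> bit" where
  "Lcm_bit = Euclidean_Algorithm.Lcm"

instance by standard (simp_all add: gcd_bit_def lcm_bit_def Gcd_bit_def Lcm_bit_def)

end

instance bit :: field_gcd ..

text \<open>
  In characteristic 2, \<^const>\<open>of_bool\<close> applied to \<open>odd\<close>, abbreviated \<open>of_bit\<close>, is the embedding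
  of the prime field.
\<close>

definition min_poly2 :: "'a::field \<Rightarrow> bit poly" where
  "min_poly2 \<beta> = (THE p. lead_coeff p = 1 \<and> poly (map_poly of_bit p) \<beta> = 0 \<and>
     (\<forall>q. q \<noteq> 0 \<and> poly (map_poly of_bit q) \<beta> = 0 \<longrightarrow> degree p \<le> degree q))"

text \<open>
  A vector \<open>[c\<^sub>0, \<dots>, c\<^sub>n\<^sub>-\<^sub>1]\<close> stands for the residue class of
  \<open>c\<^sub>0 + c\<^sub>1 x + \<dots> + c\<^sub>n\<^sub>-\<^sub>1 x\<^sup>n\<^sup>-\<^sup>1\<close> modulo \<open>x\<^sup>n - 1\<close>; the code is the principal ideal
  of the class of \<open>g\<close>.
\<close>

definition cyclic_code :: "nat \<Rightarrow> bit poly \<Rightarrow> bit list set" where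
  "cyclic_code n g = {c. length c = n \<and> (\<exists>a. [Poly c = a * g] (mod (monom 1 n - 1)))}"

definition extended_code :: "bit list set \<Rightarrow> bit list set" where
  "extended_code C = (\<lambda>c. c @ [sum_list c]) ` C"

definition support :: "bit list \<Rightarrow> nat set" where
  "support c = {i. i < length c \<and> c ! i \<noteq> 0}"

definition hamming_weight :: "bit list \<Rightarrow> nat" where
  "hamming_weight c = card (support c)"

definition two_design :: "'v set \<Rightarrow> 'v set set \<Rightarrow> nat \<Rightarrow> nat \<Rightarrow> nat \<Rightarrow> bool" where
  "two_design V B v k l \<longleftrightarrow>
     finite V \<and> card V = v \<and> (\<forall>b\<in>B. b \<subseteq> V \<and> card b = k) \<and>
     (\<forall>T. T \<subseteq> V \<and> card T = 2 \<longrightarrow> card {b \<in> B. T \<subseteq> b} = l)"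

end

theory Submission
  imports Defs
begin

text \<open>
  Write \<open>q = 2\<^sup>m\<close> and \<open>Q = 2\<^sup>e\<close>. Indexing the coordinates by the points of the field, with the
  parity coordinate at \<open>0\<close>, the words of the extended code are the sets \<open>T\<close> of even size
  with \<open>\<Sum>x = \<Sum>x\<^bsup>1+Q\<^esup> = 0\<close> over \<open>x \<in> T\<close>. This family is invariant under the affine group, which is
  doubly transitive, so every weight class is a 2-design and \<open>\<lambda>\<close> follows from the number of words
  of weight 8.

  That number comes from the moments of the character sums \<open>S(a,b) = \<Sum>\<chi>(a x\<^bsup>1+Q\<^esup> + b x)\<close>.
  The square of \<open>S(a,b)\<close> is either \<open>0\<close> or \<open>q r\<^sub>a\<close>, where \<open>r\<^sub>a\<close> is the size of the radical
  \<open>{u. a\<^sup>Q u\<^bsup>Q\<^sup>2\<^esup> = a u}\<close>, and by Parseval the squares add up to \<open>q\<^sup>2\<close> over \<open>b\<close>. For \<open>a \<noteq> 0\<close> the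
  radical has 1 or 16 elements; counting the pairs \<open>(a,u)\<close> in two ways shows that 16 occurs for
  exactly \<open>(q-1)/5\<close> values of \<open>a\<close>. The moments of order 4, 6 and 8 then determine the numbers of words of
  weight 4, 6 and 8 successively.
\<close>

section \<open>Binary fields and their additive characters\<close>

text \<open>Modulo the gcd both powers of two are 1, hence by Bezout so is
  \<open>2 ^ gcd a b\<close>. Conversely \<open>2 ^ gcd a b - 1\<close> divides
  \<open>2 ^ c - 1\<close> for every multiple \<open>c\<close> of \<open>gcd a b\<close>.\<close>

lemma gcd_two_power_minus_one:
  "gcd (2 ^ a - 1) (2 ^ b - 1 :: nat) = 2 ^ gcd a b - 1"
proof (cases "a = 0")
  case False
  have cong_iff: "[2 ^ k = 1] (mod d) \<longleftrightarrow> d dvd 2 ^ k - 1" for d k :: nat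
    by (metis cong_altdef_nat cong_sym_eq one_le_numeral one_le_power)
  have multiple: "[2 ^ (k * l) = 1] (mod d)" if "[2 ^ k = 1] (mod d)" for d k l :: nat
    using cong_pow[OF that, of l] by (simp add: power_mult)
  show ?thesis
  proof (rule dvd_antisym)
    let ?d = "gcd (2 ^ a - 1) (2 ^ b - 1 :: nat)"
    \<comment> \<open>The subtraction-free Bezout identity over the naturals needs \<open>a\<close>
      nonzero, hence the case split.\<close>
    obtain x y where xy: "a * x = b * y + gcd a b"
      using bezout_nat[OF False] by blast
    have "[2 ^ a = 1] (mod ?d)" "[2 ^ b = 1] (mod ?d)"
      by (simp_all only: cong_iff gcd_dvd1 gcd_dvd2)
    then have ax: "[2 ^ (a * x) = 1] (mod ?d)" and "[2 ^ (b * y) = 1] (mod ?d)"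
      by (blast intro: multiple)+
    then have "[2 ^ (b * y) * 2 ^ gcd a b = 1 * 2 ^ gcd a b] (mod ?d)"
      by (intro cong_mult cong_refl)
    then have "[2 ^ gcd a b = 2 ^ (a * x)] (mod ?d)"
      by (simp only: xy power_add mult_1 cong_sym_eq)
    from this ax have "[2 ^ gcd a b = 1] (mod ?d)"
      by (rule cong_trans)
    then show "?d dvd 2 ^ gcd a b - 1"
      by (simp only: cong_iff)
    have "2 ^ gcd a b - 1 dvd (2 ^ c - 1 :: nat)" if dvd_c: "gcd a b dvd c" for c
    proof -
      obtain l where "c = gcd a b * l"
        using dvd_c by blast
      moreover have "[2 ^ gcd a b = 1] (mod (2 ^ gcd a b - 1 :: nat))"
        by (simp only: cong_iff dvd_refl)
      ultimately show ?thesis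
        using multiple unfolding cong_iff[symmetric] by blast
    qed
    then show "2 ^ gcd a b - 1 dvd ?d"
      by simp
  qed
qed simp

lemma card_multiples_below:
  fixes h g :: nat
  assumes "h > 0"
  shows "card {i. i < h * g \<and> h dvd i} = g"
proof -
  have "{i. i < h * g \<and> h dvd i} = (\<lambda>j. h * j) ` {..<g}"
    using assms by (auto simp: image_iff elim!: dvdE)
  then show ?thesis
    using assms by (simp add: card_image inj_on_def)
qed

text \<open>Multiplication by \<open>x\<close> permutes the nonzero elements, so their product,
  itself nonzero, absorbs one factor \<open>x\<close> per element.\<close>

lemma nonzero_power_card_minus_one:
  fixes x :: "'a::{field,finite}"
  assumes "x \<noteq> 0"
  shows "x ^ (CARD('a) - 1) = 1"
proof -
  have "(\<Prod>y\<in>UNIV-{0}. x * y) = (\<Prod>y\<in>UNIV-{0}. y)"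
    by (rule prod.reindex_bij_witness[of _ "\<lambda>y. y / x" "\<lambda>y. x * y"]) (use assms in auto)
  then have "x ^ (CARD('a) - 1) * (\<Prod>y\<in>UNIV-{0::'a}. y) = (\<Prod>y\<in>UNIV-{0}. y)"
    by (simp add: prod.distrib card_Diff_singleton)
  then show ?thesis
    by simp
qed

text \<open>Translation by an element with \<open>\<phi> z \<noteq> 1\<close> permutes
  \<open>R\<close> and multiplies the sum by \<open>\<phi> z\<close>. Multiplicativity is asked on
  \<open>R\<close> only, so that the lemma also covers quadratic phases restricted to a
  radical.\<close>

lemma sum_character_subgroup:
  fixes \<phi> :: "'a::{ab_group_add,finite} \<Rightarrow> int"
  assumes hom: "\<And>x y. x \<in> R \<Longrightarrow> y \<in> R \<Longrightarrow> \<phi> (x + y) = \<phi> x * \<phi> y"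
    and closed: "\<And>x y. x \<in> R \<Longrightarrow> y \<in> R \<Longrightarrow> x + y \<in> R" "\<And>x. x \<in> R \<Longrightarrow> - x \<in> R"
  shows "sum \<phi> R = 0 \<or> (\<forall>x\<in>R. \<phi> x = 1)"
proof (rule disjCI)
  assume "\<not> (\<forall>x\<in>R. \<phi> x = 1)"
  then obtain z where z: "z \<in> R" "\<phi> z \<noteq> 1"
    by blast
  have "sum \<phi> R = (\<Sum>x\<in>R. \<phi> (z + x))"
    by (rule sum.reindex_bij_witness[of _ "\<lambda>x. z + x" "\<lambda>x. - z + x"])
      (use z closed in \<open>auto simp: add.assoc[symmetric] simp del: add_uminus_conv_diff uminus_add_conv_diff\<close>)
  also have "\<dots> = \<phi> z * sum \<phi> R"
    using z by (simp add: hom sum_distrib_left)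
  finally show "sum \<phi> R = 0"
    using z by simp
qed

section \<open>Primitive element and roots of unity\<close>

locale binary_field =
  fixes m :: nat and \<alpha> :: "'a::{field,finite}"
  assumes m_pos: "m > 0"
    and card_UNIV: "CARD('a) = 2 ^ m"
    and primitive: "range (\<lambda>i::nat. \<alpha> ^ i) = UNIV - {0}"
begin

lemma card_minus_one_pos: "2 ^ m - 1 > (0::nat)"
  using one_less_power[of "2::nat" m] m_pos by simp

lemma \<alpha>_nonzero: "\<alpha> \<noteq> 0"
proof -
  have "\<alpha> ^ 1 \<in> range (\<lambda>i::nat. \<alpha> ^ i)"
    by (rule rangeI)
  then show ?thesis
    using primitive by auto
qed

lemma power_card_minus_one: "x \<noteq> 0 \<Longrightarrow> x ^ (2 ^ m - 1) = 1" for x :: 'a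
  using nonzero_power_card_minus_one[of x] by (simp add: card_UNIV)

lemma power_card: "x ^ (2 ^ m) = x" for x :: 'a
proof (cases "x = 0")
  case False
  have "x ^ (2 ^ m) = x ^ Suc (2 ^ m - 1)"
    by simp
  also have "\<dots> = x"
    using power_card_minus_one[OF False] by (simp only: power_Suc mult_1_right)
  finally show ?thesis .
qed simp

lemma bij_\<alpha>_power: "bij_betw (\<lambda>i. \<alpha> ^ i) {..<2 ^ m - 1} (UNIV - {0})"
proof -
  let ?n = "2 ^ m - 1 :: nat"
  note n = card_minus_one_pos
  have red: "\<alpha> ^ i = \<alpha> ^ (i mod ?n)" for i
  proof -
    have "\<alpha> ^ i = \<alpha> ^ (?n * (i div ?n) + i mod ?n)"
      by simp
    then show ?thesis
      by (simp only: power_add power_mult power_card_minus_one[OF \<alpha>_nonzero]) simp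
  qed
  have img: "(\<lambda>i. \<alpha> ^ i) ` {..<?n} = UNIV - {0}"
  proof
    show "(\<lambda>i. \<alpha> ^ i) ` {..<?n} \<subseteq> UNIV - {0}"
      using primitive by blast
    show "UNIV - {0} \<subseteq> (\<lambda>i. \<alpha> ^ i) ` {..<?n}"
      unfolding primitive[symmetric] using red n
      by (metis (no_types, lifting) image_iff image_subsetI lessThan_iff mod_less_divisor)
  qed
  have "inj_on (\<lambda>i. \<alpha> ^ i) {..<?n}"
    by (rule eq_card_imp_inj_on) (simp_all only: img, simp_all add: card_Diff_singleton card_UNIV)
  with img show ?thesis
    by (simp add: bij_betw_def)
qed

lemma \<alpha>_power_eq_1_iff: "\<alpha> ^ i = 1 \<longleftrightarrow> 2 ^ m - 1 dvd i"
proof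
  let ?n = "2 ^ m - 1 :: nat"
  note n = card_minus_one_pos
  have "\<alpha> ^ i = \<alpha> ^ (?n * (i div ?n) + i mod ?n)"
    by simp
  then have red: "\<alpha> ^ i = \<alpha> ^ (i mod ?n)"
    by (simp only: power_add power_mult power_card_minus_one[OF \<alpha>_nonzero]) simp
  show "?n dvd i" if "\<alpha> ^ i = 1"
  proof -
    have "\<alpha> ^ (i mod ?n) = \<alpha> ^ 0"
      using red that by simp
    then have "i mod ?n = 0"
      using bij_\<alpha>_power n unfolding bij_betw_def inj_on_def by (metis lessThan_iff mod_less_divisor)
    then show ?thesis
      by (simp add: mod_eq_0_iff_dvd)
  qed
  show "\<alpha> ^ i = 1" if "?n dvd i"
    using that red by (simp add: mod_eq_0_iff_dvd)
qed

text \<open>With \<open>x = \<alpha> ^ i\<close> the equation becomes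
  \<open>2 ^ m - 1 dvd i * d\<close>. Cancelling the gcd leaves \<open>h dvd i\<close>, and exactly
  \<open>g\<close> multiples of \<open>h\<close> lie below \<open>2 ^ m - 1 = h * g\<close>.\<close>

lemma card_roots_of_unity:
  assumes "d > 0"
  shows "card {x::'a. x ^ d = 1} = gcd d (2 ^ m - 1)"
proof -
  let ?n = "2 ^ m - 1 :: nat"
  define g where "g = gcd d ?n"
  note n = card_minus_one_pos
  have g: "g > 0"
    using assms by (simp add: g_def)
  obtain d' h where h: "d = d' * g" "?n = h * g" "coprime d' h"
    using gcd_coprime_exists[of d ?n] g unfolding g_def by blast
  have h0: "h > 0"
    using h(2) n by (cases "h = 0") auto
  have root_iff: "(\<alpha> ^ i) ^ d = 1 \<longleftrightarrow> ?n dvd i * d" for i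
    by (simp only: power_mult[symmetric] \<alpha>_power_eq_1_iff)
  have roots: "{x::'a. x ^ d = 1} = (\<lambda>i. \<alpha> ^ i) ` {i. i < ?n \<and> ?n dvd i * d}"
  proof (intro set_eqI iffI)
    fix x :: 'a
    assume "x \<in> {x. x ^ d = 1}"
    then have x: "x ^ d = 1" by simp
    \<comment> \<open>Positivity of \<open>d\<close> excludes zero, because
      \<open>0 ^ 0 = 1\<close>.\<close>
    with assms have "x \<in> UNIV - {0}"
      by (auto simp: power_0_left)
    then have "x \<in> (\<lambda>i. \<alpha> ^ i) ` {..<?n}"
      using bij_\<alpha>_power by (simp only: bij_betw_def)
    then obtain i where i: "i < ?n" "x = \<alpha> ^ i"
      by blast
    with x have "?n dvd i * d"
      by (simp only: root_iff)
    with i show "x \<in> (\<lambda>i. \<alpha> ^ i) ` {i. i < ?n \<and> ?n dvd i * d}"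
      by blast
  qed (use root_iff in blast)
  have "card {x::'a. x ^ d = 1} = card {i. i < ?n \<and> ?n dvd i * d}"
    unfolding roots by (intro card_image inj_on_subset[OF bij_betw_imp_inj_on[OF bij_\<alpha>_power]]) blast
  also have "\<dots> = card {i. i < h * g \<and> h dvd i}"
  proof -
    have "coprime h d'"
      using h(3) by (simp only: coprime_commute)
    then have "h * g dvd (i * d') * g \<longleftrightarrow> h dvd i" for i
      using g by (subst dvd_times_right_cancel_iff) (simp_all add: coprime_dvd_mult_left_iff)
    then show ?thesis
      by (simp only: h mult.assoc)
  qed
  also have "\<dots> = g"
    by (rule card_multiples_below) (rule h0)
  finally show ?thesis
    by (simp add: g_def)
qed

section \<open>Characteristic two and the Frobenius maps\<close>

lemma neg_one_eq_one: "- 1 = (1::'a)"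
  \<comment> \<open>The exponent \<open>2 ^ m\<close> is even, so the power that must equal
    \<open>- 1\<close> is also 1.\<close>
  using power_card[of "-1"] m_pos by simp

lemma uminus_char2 [simp]: "- x = (x::'a)"
  using neg_one_eq_one by (metis mult_minus1 mult_1)

lemma minus_char2 [simp]: "x - y = x + (y::'a)"
  by (metis diff_conv_add_uminus uminus_char2)

lemma add_self [simp]: "x + x = (0::'a)"
  by (metis add.right_inverse uminus_char2)

lemma two_eq_0 [simp]: "(2::'a) = 0"
  by (metis add_self one_add_one)

lemma add_eq_0_iff_eq: "x + y = 0 \<longleftrightarrow> x = (y::'a)"
  by (metis eq_neg_iff_add_eq_0 uminus_char2)

lemma frobenius_add: "(x + y) ^ (2 ^ i) = x ^ (2 ^ i) + (y::'a) ^ (2 ^ i)"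
proof (induction i)
  case (Suc i)
  have "(x + y) ^ (2 ^ Suc i) = ((x + y) ^ (2 ^ i)) ^ 2"
    by (simp add: power_mult[symmetric] mult.commute)
  then show ?case
    by (simp add: Suc power2_sum two_eq_0 power_mult[symmetric] mult.commute)
qed simp

lemma frobenius_sum: "sum f A ^ (2 ^ i) = (\<Sum>a\<in>A. (f a :: 'a) ^ (2 ^ i))"
  by (induction A rule: infinite_finite_induct) (simp_all add: frobenius_add)

text \<open>An additive map with trivial kernel is injective, hence surjective on a finite
  set.\<close>

lemma surj_frobenius: "surj (\<lambda>x::'a. x ^ (2 ^ i))"
proof -
  have "inj (\<lambda>x::'a. x ^ (2 ^ i))"
  proof (rule injI)
    fix x y :: 'a
    assume "x ^ (2 ^ i) = y ^ (2 ^ i)"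
    then have "(x + y) ^ (2 ^ i) = 0"
      by (simp add: frobenius_add)
    then show "x = y"
      by (simp add: add_eq_0_iff_eq)
  qed
  then show ?thesis
    by (simp add: finite_UNIV_inj_surj)
qed

section \<open>Absolute trace and the canonical additive character\<close>

definition trace :: "'a \<Rightarrow> 'a" where
  "trace x = (\<Sum>i<m. x ^ (2 ^ i))"

lemma trace_add: "trace (x + y) = trace x + trace y"
  by (simp add: trace_def frobenius_add sum.distrib)

text \<open>Squaring shifts the conjugates, and \<open>x ^ (2 ^ m) = x\<close> closes the
  cycle.\<close>

lemma trace_square: "trace (x ^ 2) = trace x"
proof -
  have "x + trace (x ^ 2) = (\<Sum>i<Suc m. x ^ (2 ^ i))"
    by (subst sum.lessThan_Suc_shift) (simp add: trace_def power_mult[symmetric])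
  also have "\<dots> = x + trace x"
    by (simp add: trace_def power_card add.commute)
  finally show ?thesis
    by simp
qed

lemma trace_frobenius: "trace (x ^ (2 ^ i)) = trace x"
proof (induction i)
  case (Suc i)
  have "trace (x ^ (2 ^ Suc i)) = trace ((x ^ (2 ^ i)) ^ 2)"
    by (simp add: power_mult[symmetric] mult.commute)
  then show ?case
    by (simp add: trace_square Suc)
qed simp

text \<open>The trace equals its own square, so it solves \<open>t * t = t\<close> in a
  field.\<close>

lemma trace_cases: "trace x = 0 \<or> trace x = 1"
proof -
  have "trace x ^ 2 = trace (x ^ 2)"
    using frobenius_sum[of "\<lambda>i. x ^ (2 ^ i)" "{..<m}" 1]
    by (simp add: trace_def power_mult[symmetric] mult.commute)
  then have "trace x * trace x = trace x"
    by (simp only: trace_square power2_eq_square[of "trace x"])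
  then show ?thesis
    by simp
qed

text \<open>A vanishing trace would make all \<open>2 ^ m\<close> field elements roots of a nonzero
  polynomial of degree at most \<open>2 ^ (m - 1)\<close>.\<close>

lemma trace_nontrivial: "\<exists>x. trace x \<noteq> 0"
proof (rule ccontr)
  assume "\<nexists>x. trace x \<noteq> 0"
  then have zero: "trace x = 0" for x
    by blast
  define p :: "'a poly" where "p = (\<Sum>i<m. monom 1 (2 ^ i))"
  \<comment> \<open>Only the term \<open>i = 0\<close> has exponent 1, so the linear coefficient
    witnesses \<open>p \<noteq> 0\<close>.\<close>
  have "coeff p 1 = (\<Sum>i<m. if i = 0 then 1 else 0)"
    unfolding p_def coeff_sum by (intro sum.cong) auto
  then have "p \<noteq> 0"
    using m_pos by auto
  then have "card {x. poly p x = 0} \<le> degree p"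
    by (rule card_poly_roots_bound)
  also have "{x. poly p x = 0} = UNIV"
    using zero by (auto simp: p_def poly_sum poly_monom trace_def)
  also have "degree p \<le> 2 ^ (m - 1)"
    unfolding p_def by (intro degree_sum_le) (auto simp: degree_monom_eq)
  finally show False
    using m_pos by (simp add: card_UNIV)
qed

definition chi :: "'a \<Rightarrow> int" where
  "chi x = (if trace x = 0 then 1 else - 1)"

lemma chi_add: "chi (x + y) = chi x * chi y"
  using trace_cases[of x] trace_cases[of y] by (auto simp: chi_def trace_add)

lemma chi_0 [simp]: "chi 0 = 1"
  using m_pos by (simp add: chi_def trace_def power_0_left)

lemma chi_sum: "chi (sum f A) = (\<Prod>a\<in>A. chi (f a))"
  by (induction A rule: infinite_finite_induct) (simp_all add: chi_add)

lemma chi_frobenius: "chi (x ^ (2 ^ i)) = chi x"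
  by (simp add: chi_def trace_frobenius)

lemma chi_nondegenerate:
  assumes "\<And>x. chi (c * x) = 1"
  shows "c = 0"
proof (rule ccontr)
  assume "c \<noteq> 0"
  obtain y where "trace y \<noteq> 0"
    using trace_nontrivial by blast
  with assms[of "y / c"] \<open>c \<noteq> 0\<close> show False
    by (simp add: chi_def)
qed

lemma sum_chi_mult: "(\<Sum>x\<in>UNIV. chi (c * x)) = (if c = 0 then 2 ^ m else 0)"
proof (cases "c = 0")
  case False
  have "(\<Sum>x\<in>UNIV. chi (c * x)) = 0 \<or> (\<forall>x\<in>UNIV. chi (c * x) = 1)"
    by (rule sum_character_subgroup) (simp_all add: distrib_left chi_add)
  with False chi_nondegenerate show ?thesis
    by auto
qed (simp add: card_UNIV)

end

section \<open>Power moments of character sums\<close>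

text \<open>
  \<open>odd_words q k t\<close> is the number of words of length \<open>k\<close> over \<open>q\<close> letters in which exactly the
  letters of a given \<open>t\<close>-set occur an odd number of times; the recursion removes one letter.
\<close>

fun odd_words :: "int \<Rightarrow> nat \<Rightarrow> nat \<Rightarrow> int" where
  "odd_words q 0 t = (if t = 0 then 1 else 0)"
| "odd_words q (Suc k) t =
     int t * odd_words q k (t - 1) + (q - int t) * odd_words q k (t + 1)"

text \<open>Expand the power over words of length \<open>k\<close>. As all values square to 1, the
  product along a word depends only on the set of letters of odd multiplicity.\<close>

lemma sum_power_eq_odd_words:
  fixes \<phi> :: "'a::finite \<Rightarrow> int"
  assumes sq: "\<And>x. \<phi> x * \<phi> x = 1"
  shows "(\<Sum>x\<in>UNIV. \<phi> x) ^ k = (\<Sum>T\<in>UNIV. odd_words (int CARD('a)) k (card T) * prod \<phi> T)"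
proof (induction k)
  case 0
  have "(\<Sum>T\<in>UNIV. odd_words (int CARD('a)) 0 (card T) * prod \<phi> T)
      = (\<Sum>T::'a set\<in>UNIV. if T = {} then 1 else 0)"
    by (intro sum.cong) auto
  then show ?case
    by simp
next
  case (Suc k)
  let ?w = "odd_words (int CARD('a))"
  \<comment> \<open>Adding a letter \<open>x\<close> to a word toggles \<open>x\<close> in its set
    of odd letters.\<close>
  define toggle where "toggle x T = (if x \<in> T then T - {x} else insert x T)" for x :: 'a and T
  have invol: "toggle x (toggle x T) = T" for x T
    by (auto simp: toggle_def)
  have prod_toggle: "\<phi> x * prod \<phi> T = prod \<phi> (toggle x T)" for x T
  proof (cases "x \<in> T")
    case True
    then have "prod \<phi> T = \<phi> x * prod \<phi> (T - {x})"
      by (simp add: prod.remove)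
    then show ?thesis
      using True sq[of x] by (simp add: toggle_def mult.assoc[symmetric])
  qed (simp add: toggle_def)
  \<comment> \<open>Toggling a member of \<open>T\<close> lowers the size by one, toggling any other
    letter raises it; this is the recursion of \<open>odd_words\<close>.\<close>
  have count: "(\<Sum>x\<in>UNIV. ?w k (card (toggle x T))) = ?w (Suc k) (card T)" for T
  proof -
    have "(\<Sum>x\<in>UNIV. ?w k (card (toggle x T)))
        = (\<Sum>x\<in>T. ?w k (card (toggle x T))) + (\<Sum>x\<in>-T. ?w k (card (toggle x T)))"
      by (subst sum.union_disjoint[symmetric]) auto
    also have "(\<Sum>x\<in>T. ?w k (card (toggle x T))) = (\<Sum>x\<in>T. ?w k (card T - 1))"
      by (intro sum.cong) (auto simp: toggle_def)
    also have "(\<Sum>x\<in>-T. ?w k (card (toggle x T))) = (\<Sum>x\<in>-T. ?w k (card T + 1))"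
      by (intro sum.cong) (auto simp: toggle_def)
    finally show ?thesis
      by (simp add: Compl_eq_Diff_UNIV card_Diff_subset of_nat_diff card_mono)
  qed
  have "(\<Sum>x\<in>UNIV. \<phi> x) ^ Suc k
      = (\<Sum>x\<in>UNIV. \<Sum>T\<in>UNIV. ?w k (card T) * prod \<phi> (toggle x T))"
    by (simp add: Suc sum_product prod_toggle[symmetric] mult_ac)
  also have "\<dots> = (\<Sum>x\<in>UNIV. \<Sum>T\<in>UNIV. ?w k (card (toggle x T)) * prod \<phi> T)"
  proof (rule sum.cong[OF refl])
    fix x
    show "(\<Sum>T\<in>UNIV. ?w k (card T) * prod \<phi> (toggle x T)) =
        (\<Sum>T\<in>UNIV. ?w k (card (toggle x T)) * prod \<phi> T)"
      by (rule sum.reindex_bij_witness[of _ "toggle x" "toggle x"]) (simp_all add: invol)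
  qed
  also have "\<dots> = (\<Sum>T\<in>UNIV. ?w (Suc k) (card T) * prod \<phi> T)"
    by (subst sum.swap) (simp only: count[symmetric] sum_distrib_right)
  finally show ?case .
qed

context binary_field
begin

definition walsh :: "('a \<Rightarrow> 'a) \<Rightarrow> 'a \<Rightarrow> 'a \<Rightarrow> int" where
  "walsh f a b = (\<Sum>x\<in>UNIV. chi (a * f x + b * x))"

definition zero_sum_sets :: "('a \<Rightarrow> 'a) \<Rightarrow> 'a set set" where
  "zero_sum_sets f = {T. (\<Sum>x\<in>T. x) = 0 \<and> (\<Sum>x\<in>T. f x) = 0}"

text \<open>After exchanging sums, each \<open>T\<close> carries a product of two character sums,
  over \<open>a\<close> and over \<open>b\<close>. Orthogonality kills it unless both defining sums
  over \<open>T\<close> vanish.\<close>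

lemma sum_walsh_power:
  "(\<Sum>a\<in>UNIV. \<Sum>b\<in>UNIV. walsh f a b ^ k) =
     2 ^ m * 2 ^ m * (\<Sum>T\<in>zero_sum_sets f. odd_words (2 ^ m) k (card T))"
proof -
  let ?w = "\<lambda>T::'a set. odd_words (2 ^ m) k (card T)"
  have chi_sq: "chi x * chi x = 1" for x
    by (simp add: chi_def)
  have expand: "walsh f a b ^ k =
      (\<Sum>T\<in>UNIV. ?w T * (chi ((\<Sum>x\<in>T. f x) * a) * chi ((\<Sum>x\<in>T. x) * b)))" for a b
  proof -
    have "(\<Prod>x\<in>T. chi (a * f x + b * x)) = chi ((\<Sum>x\<in>T. f x) * a) * chi ((\<Sum>x\<in>T. x) * b)" for T
    proof -
      have "(\<Sum>x\<in>T. a * f x + b * x) = a * (\<Sum>x\<in>T. f x) + b * (\<Sum>x\<in>T. x)"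
        by (simp only: sum.distrib sum_distrib_left)
      then show ?thesis
        unfolding chi_sum[symmetric] by (simp only: chi_add mult.commute)
    qed
    then show ?thesis
      using sum_power_eq_odd_words[of "\<lambda>x. chi (a * f x + b * x)" k]
      by (simp add: walsh_def chi_sq card_UNIV)
  qed
  have "(\<Sum>a\<in>UNIV. \<Sum>b\<in>UNIV. walsh f a b ^ k) = (\<Sum>a\<in>UNIV. \<Sum>T\<in>UNIV. \<Sum>b\<in>UNIV.
      ?w T * (chi ((\<Sum>x\<in>T. f x) * a) * chi ((\<Sum>x\<in>T. x) * b)))"
    unfolding expand by (intro sum.cong refl sum.swap)
  also have "\<dots> = (\<Sum>T\<in>UNIV. \<Sum>a\<in>UNIV. \<Sum>b\<in>UNIV.
      ?w T * (chi ((\<Sum>x\<in>T. f x) * a) * chi ((\<Sum>x\<in>T. x) * b)))"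
    by (rule sum.swap)
  also have "\<dots> = (\<Sum>T\<in>UNIV. ?w T *
      ((\<Sum>a\<in>UNIV. chi ((\<Sum>x\<in>T. f x) * a)) * (\<Sum>b\<in>UNIV. chi ((\<Sum>x\<in>T. x) * b))))"
    unfolding sum_product by (simp only: sum_distrib_left)
  also have "\<dots> = (\<Sum>T\<in>UNIV. if T \<in> zero_sum_sets f then 2 ^ m * 2 ^ m * ?w T else 0)"
    unfolding sum_chi_mult by (intro sum.cong) (auto simp: zero_sum_sets_def)
  also have "\<dots> = (\<Sum>T\<in>zero_sum_sets f. 2 ^ m * 2 ^ m * ?w T)"
    by (simp add: sum.If_cases)
  finally show ?thesis
    by (simp add: sum_distrib_left)
qed

end

section \<open>Gold function, polar form and radical\<close>

locale gold = binary_field +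
  fixes e :: nat
  assumes four_dvd: "4 dvd m" and gcd_m_e: "gcd m e = 2"
begin

definition gold_fun :: "'a \<Rightarrow> 'a" where
  "gold_fun x = x ^ (1 + 2 ^ e)"

text \<open>
  The radical of the polar form of the quadratic form \<open>x \<mapsto> Tr(a x\<^bsup>1+Q\<^esup>)\<close>.
\<close>

definition radical :: "'a \<Rightarrow> 'a set" where
  "radical a = {u. a ^ (2 ^ e) * (u ^ (2 ^ e)) ^ (2 ^ e) = a * u}"

lemma gold_fun_add:
  "gold_fun (x + y) = gold_fun x + gold_fun y + (x * y ^ (2 ^ e) + x ^ (2 ^ e) * y)"
  by (simp add: gold_fun_def power_add frobenius_add algebra_simps)

lemma zero_in_radical: "0 \<in> radical a"
  by (simp add: radical_def)

lemma radical_add: "u \<in> radical a \<Longrightarrow> v \<in> radical a \<Longrightarrow> u + v \<in> radical a"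
  by (simp add: radical_def frobenius_add distrib_left)

text \<open>Frobenius invariance of \<open>chi\<close> allows raising the second summand to the
  power \<open>2 ^ e\<close>. The result is linear in \<open>x ^ (2 ^ e)\<close>, with a coefficient
  that vanishes exactly on the radical.\<close>

lemma chi_polar:
  "chi (a * (u * x ^ (2 ^ e) + u ^ (2 ^ e) * x)) =
     chi ((a * u + a ^ (2 ^ e) * (u ^ (2 ^ e)) ^ (2 ^ e)) * x ^ (2 ^ e))"
proof -
  have "chi (a * (u * x ^ (2 ^ e) + u ^ (2 ^ e) * x))
      = chi (a * u * x ^ (2 ^ e)) * chi ((a * u ^ (2 ^ e) * x) ^ (2 ^ e))"
    by (simp only: chi_frobenius chi_add[symmetric] distrib_left mult.assoc)
  then show ?thesis
    by (simp only: power_mult_distrib distrib_right chi_add)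
qed

lemma sum_chi_polar:
  "(\<Sum>x\<in>UNIV. chi (a * (u * x ^ (2 ^ e) + u ^ (2 ^ e) * x))) =
     (if u \<in> radical a then 2 ^ m else 0)"
proof -
  let ?c = "a * u + a ^ (2 ^ e) * (u ^ (2 ^ e)) ^ (2 ^ e)"
  have "bij (\<lambda>x::'a. x ^ (2 ^ e))"
    using surj_frobenius[of e] by (simp add: bij_def finite_UNIV_surj_inj)
  then have "(\<Sum>x\<in>UNIV. chi (?c * x ^ (2 ^ e))) = (\<Sum>z\<in>UNIV. chi (?c * z))"
    by (rule sum.reindex_bij_betw)
  also have "\<dots> = (if u \<in> radical a then 2 ^ m else 0)"
    unfolding sum_chi_mult by (auto simp: radical_def add_eq_0_iff_eq)
  finally show ?thesis
    by (simp only: chi_polar)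
qed

text \<open>Substituting \<open>y = u + x\<close> in the double sum leaves only the polar form
  depending on \<open>x\<close>; summing over \<open>x\<close> first selects the \<open>u\<close> in
  the radical.\<close>

lemma walsh_gold_square:
  "walsh gold_fun a b ^ 2 = 2 ^ m * (\<Sum>u\<in>radical a. chi (a * gold_fun u + b * u))"
proof -
  let ?p = "\<lambda>x. a * gold_fun x + b * x"
  have shift: "chi (?p x) * chi (?p (u + x)) =
      chi (?p u) * chi (a * (u * x ^ (2 ^ e) + u ^ (2 ^ e) * x))" for u x
  proof -
    have "?p x + ?p (u + x) = (?p x + ?p x) + (?p u + a * (u * x ^ (2 ^ e) + u ^ (2 ^ e) * x))"
      by (simp only: gold_fun_add distrib_left ac_simps)
    then show ?thesis
      by (simp only: chi_add[symmetric] add_self add_0_left)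
  qed
  have "walsh gold_fun a b ^ 2 = (\<Sum>x\<in>UNIV. \<Sum>y\<in>UNIV. chi (?p x) * chi (?p y))"
    by (simp add: walsh_def power2_eq_square sum_product)
  also have "\<dots> = (\<Sum>x\<in>UNIV. \<Sum>u\<in>UNIV. chi (?p x) * chi (?p (u + x)))"
  proof (rule sum.cong[OF refl])
    fix x
    show "(\<Sum>y\<in>UNIV. chi (?p x) * chi (?p y)) = (\<Sum>u\<in>UNIV. chi (?p x) * chi (?p (u + x)))"
      by (rule sum.reindex_bij_witness[of _ "\<lambda>u. u + x" "\<lambda>u. u + x"]) (simp_all add: add.assoc)
  qed
  also have "\<dots> = (\<Sum>u\<in>UNIV. chi (?p u) *
      (\<Sum>x\<in>UNIV. chi (a * (u * x ^ (2 ^ e) + u ^ (2 ^ e) * x))))"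
    unfolding shift sum_distrib_left by (rule sum.swap)
  also have "\<dots> = (\<Sum>u\<in>UNIV. if u \<in> radical a then 2 ^ m * chi (?p u) else 0)"
    unfolding sum_chi_polar by (intro sum.cong) auto
  also have "\<dots> = (\<Sum>u\<in>radical a. 2 ^ m * chi (?p u))"
    by (simp add: sum.If_cases)
  finally show ?thesis
    by (simp add: sum_distrib_left)
qed

text \<open>On the radical the polar form has trivial character, so the phase is a homomorphism
  there and its sum is zero or the size of the radical.\<close>

lemma walsh_gold_square_cases:
  "walsh gold_fun a b ^ 2 \<in> {0, 2 ^ m * int (card (radical a))}"
proof -
  let ?\<phi> = "\<lambda>u. chi (a * gold_fun u + b * u)"
  have "sum ?\<phi> (radical a) = 0 \<or> (\<forall>u\<in>radical a. ?\<phi> u = 1)"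
  proof (rule sum_character_subgroup)
    fix u v
    assume u: "u \<in> radical a"
    have "chi (a * (u * v ^ (2 ^ e) + u ^ (2 ^ e) * v)) = 1"
      unfolding chi_polar using u by (simp add: radical_def)
    moreover have "?\<phi> (u + v) = ?\<phi> u * ?\<phi> v * chi (a * (u * v ^ (2 ^ e) + u ^ (2 ^ e) * v))"
      unfolding chi_add[symmetric] gold_fun_add by (simp only: distrib_left ac_simps)
    ultimately show "?\<phi> (u + v) = ?\<phi> u * ?\<phi> v"
      by simp
  qed (simp_all add: radical_add)
  then show ?thesis
    by (auto simp: walsh_gold_square)
qed

text \<open>Parseval: summation over \<open>b\<close> retains only the term \<open>u = 0\<close> of
  the radical.\<close>

lemma sum_walsh_gold_square: "(\<Sum>b\<in>UNIV. walsh gold_fun a b ^ 2) = 2 ^ m * 2 ^ m"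
proof -
  have split: "chi (a * gold_fun u + b * u) = chi (a * gold_fun u) * chi (u * b)" for u b
    by (simp only: chi_add mult.commute)
  have "(\<Sum>b\<in>UNIV. walsh gold_fun a b ^ 2)
      = 2 ^ m * (\<Sum>u\<in>radical a. chi (a * gold_fun u) * (\<Sum>b\<in>UNIV. chi (u * b)))"
    unfolding walsh_gold_square sum_distrib_left[symmetric] split
    by (subst sum.swap) (simp only: sum_distrib_left)
  also have "\<dots> = 2 ^ m * (\<Sum>u\<in>radical a. if u = 0 then 2 ^ m else 0)"
    unfolding sum_chi_mult
    by (intro arg_cong[where f = "\<lambda>s. 2 ^ m * s"] sum.cong) (auto simp: gold_fun_def)
  finally show ?thesis
    by (simp add: zero_in_radical)
qed

text \<open>For fixed \<open>a\<close> the square takes at most one nonzero value, so each higher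
  even moment is the second moment times a power of that value.\<close>

lemma sum_walsh_gold_power:
  "(\<Sum>b\<in>UNIV. walsh gold_fun a b ^ (2 * Suc j)) =
     2 ^ m * 2 ^ m * (2 ^ m * int (card (radical a))) ^ j"
proof -
  have "walsh gold_fun a b ^ (2 * Suc j) =
      walsh gold_fun a b ^ 2 * (2 ^ m * int (card (radical a))) ^ j" for b
    using walsh_gold_square_cases[of a b] unfolding power_mult by auto
  then have "(\<Sum>b\<in>UNIV. walsh gold_fun a b ^ (2 * Suc j)) =
      (\<Sum>b\<in>UNIV. walsh gold_fun a b ^ 2) * (2 ^ m * int (card (radical a))) ^ j"
    by (simp only: sum_distrib_right)
  then show ?thesis
    by (simp only: sum_walsh_gold_square)
qed

lemma odd_words_zero_sum_sets:
  "(\<Sum>T\<in>zero_sum_sets gold_fun. odd_words (2 ^ m) (2 * Suc j) (card T)) =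
     2 ^ (m * j) * (\<Sum>a\<in>UNIV. int (card (radical a)) ^ j)"
proof -
  have "2 ^ m * 2 ^ m * (\<Sum>T\<in>zero_sum_sets gold_fun. odd_words (2 ^ m) (2 * Suc j) (card T)) =
      2 ^ m * 2 ^ m * (2 ^ (m * j) * (\<Sum>a\<in>UNIV. int (card (radical a)) ^ j))"
    unfolding sum_walsh_power[symmetric] sum_walsh_gold_power
    by (simp only: sum_distrib_left power_mult_distrib power_mult)
  then show ?thesis
    by simp
qed

section \<open>Distribution of the radical sizes\<close>

lemma e_pos: "e > 0"
  \<comment> \<open>The value \<open>e = 0\<close> would give \<open>m = 2\<close>, contradicting
    \<open>4 dvd m\<close>.\<close>
  using four_dvd gcd_m_e by (cases "e = 0") auto

lemma card_roots_e: "card {x::'a. x ^ (2 ^ e - 1) = 1} = 3"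
proof -
  have "2 ^ e - 1 > (0::nat)"
    using one_less_power[of "2::nat" e] e_pos by simp
  then show ?thesis
    using card_roots_of_unity gcd_two_power_minus_one[of e m] gcd_m_e
    by (simp add: gcd.commute)
qed

text \<open>The count is \<open>2 ^ gcd (2 * e) m - 1\<close>. Writing \<open>m = 4 * k\<close> and
  \<open>e = 2 * d\<close>, the condition \<open>gcd m e = 2\<close> makes \<open>d\<close> coprime
  to \<open>k\<close>, so this gcd is 4.\<close>

lemma card_roots_2e: "card {x::'a. x ^ (2 ^ (2 * e) - 1) = 1} = 15"
proof -
  have pos: "2 ^ (2 * e) - 1 > (0::nat)"
    using one_less_power[of "2::nat" "2 * e"] e_pos by simp
  obtain k where k: "m = 4 * k"
    using four_dvd by blast
  have "even e"
    using gcd_m_e by (metis gcd_dvd2)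
  then obtain d where d: "e = 2 * d"
    by blast
  have "gcd (2 * (2 * k)) (2 * d) = 2 * gcd (2 * k) d"
    by (rule gcd_mult_distrib_nat[symmetric])
  then have "gcd (2 * k) d = 1"
    using gcd_m_e k d by simp
  then have "gcd k d = 1"
    by (simp only: coprime_iff_gcd_eq_1[symmetric] coprime_mult_left_iff)
  then have "gcd (2 * e) m = 4"
    using gcd_mult_distrib_nat[of 4 d k] by (simp add: k d gcd.commute)
  then show ?thesis
    using card_roots_of_unity[OF pos] gcd_two_power_minus_one[of "2 * e" m] by simp
qed

text \<open>For nonzero \<open>a\<close>, the radical equation divided by \<open>a * u\<close>; its
  solutions are the nonzero elements of the radical.\<close>

definition radical_units :: "'a \<Rightarrow> 'a set" where
  "radical_units a = {u. a ^ (2 ^ e - 1) * u ^ (2 ^ (2 * e) - 1) = 1}"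

lemma radical_units_nonzero: "u \<in> radical_units a \<Longrightarrow> u \<noteq> 0"
  using e_pos one_less_power[of "2::nat" "2 * e"]
  by (auto simp: radical_units_def power_0_left split: if_splits)

lemma radical_eq:
  assumes "a \<noteq> 0"
  shows "radical a = insert 0 (radical_units a)"
proof -
  have red: "x ^ (2 ^ i) = x * x ^ (2 ^ i - 1)" for x :: 'a and i
    by (metis Suc_diff_1 pos2 power_Suc zero_less_power)
  have "u \<in> radical a \<longleftrightarrow> u \<in> radical_units a" if "u \<noteq> 0" for u
  proof -
    have "(u ^ (2 ^ e)) ^ (2 ^ e) = u ^ (2 ^ (2 * e))"
      by (simp only: power_mult[symmetric] power_add[symmetric] mult_2)
    then have "a ^ (2 ^ e) * (u ^ (2 ^ e)) ^ (2 ^ e) =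
        a * u * (a ^ (2 ^ e - 1) * u ^ (2 ^ (2 * e) - 1))"
      by (simp only: red[of a e] red[of u "2 * e"]) (simp only: mult_ac)
    then have "u \<in> radical a \<longleftrightarrow>
        a * u * (a ^ (2 ^ e - 1) * u ^ (2 ^ (2 * e) - 1)) = a * u * 1"
      by (simp only: radical_def mem_Collect_eq mult_1_right)
    also have "\<dots> \<longleftrightarrow> u \<in> radical_units a"
      unfolding radical_units_def using assms that by (subst mult_cancel_left) simp
    finally show ?thesis .
  qed
  then have "u \<in> radical a \<longleftrightarrow> u \<in> insert 0 (radical_units a)" for u
    by (cases "u = 0") (simp_all add: zero_in_radical)
  then show ?thesis
    by (rule set_eqI)
qed

text \<open>A nonempty solution set is a coset of the group of solutions of
  \<open>x ^ (2 ^ (2 * e) - 1) = 1\<close>, which has 15 elements.\<close>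

lemma card_radical_units: "card (radical_units a) \<in> {0, 15}"
proof (cases "radical_units a = {}")
  case False
  let ?k = "2 ^ (2 * e) - 1 :: nat"
  from False obtain v where v: "v \<in> radical_units a"
    by blast
  then have v0: "v \<noteq> 0"
    by (rule radical_units_nonzero)
  have "radical_units a = (\<lambda>x. v * x) ` {x. x ^ ?k = 1}"
  proof (intro equalityI subsetI)
    fix u
    assume "u \<in> radical_units a"
    with v have "u ^ ?k = v ^ ?k"
    proof -
      have "a ^ (2 ^ e - 1) * u ^ ?k = 1" and v1: "a ^ (2 ^ e - 1) * v ^ ?k = 1"
        using \<open>u \<in> radical_units a\<close> v by (simp_all only: radical_units_def mem_Collect_eq)
      moreover from v1 have "a ^ (2 ^ e - 1) \<noteq> 0"
        by (metis mult_zero_left zero_neq_one)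
      ultimately show ?thesis
        by (metis mult_left_cancel)
    qed
    then have "(u / v) ^ ?k = 1"
      using v0 by (simp add: power_divide)
    with v0 show "u \<in> (\<lambda>x. v * x) ` {x. x ^ ?k = 1}"
      by (intro image_eqI[of _ _ "u / v"]) auto
  qed (use v in \<open>auto simp: radical_units_def power_mult_distrib\<close>)
  then have "card (radical_units a) = 15"
    using card_roots_2e v0 by (simp add: card_image inj_on_def)
  then show ?thesis
    by simp
qed simp

text \<open>Incidences are counted from the side of \<open>u\<close>: for each nonzero
  \<open>u\<close> exactly three \<open>a\<close> qualify.\<close>

lemma sum_card_radical_units:
  "(\<Sum>a\<in>UNIV-{0}. card (radical_units a)) = 3 * (2 ^ m - 1)"
proof -
  have fiber: "card {a. a \<noteq> 0 \<and> u \<in> radical_units a} = 3" if "u \<noteq> 0" for u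
  proof -
    \<comment> \<open>Since \<open>2 ^ (2 * e) - 1 = (2 ^ e + 1) * (2 ^ e - 1)\<close>, this
      \<open>c\<close> turns the condition on \<open>a\<close> into a root-of-unity equation for
      \<open>c * a\<close>.\<close>
    define c where "c = u ^ (2 ^ e + 1)"
    have c: "c \<noteq> 0"
      using that by (simp add: c_def)
    have "(2 ^ e + 1) * (2 ^ e - 1) = (2 ^ (2 * e) - 1 :: nat)"
      by (simp only: mult_2 power_add) (simp add: algebra_simps)
    then have "u ^ (2 ^ (2 * e) - 1) = c ^ (2 ^ e - 1)"
      by (simp only: c_def power_mult[symmetric])
    then have iff: "u \<in> radical_units a \<longleftrightarrow> (c * a) ^ (2 ^ e - 1) = 1" for a
      by (simp only: radical_units_def mem_Collect_eq power_mult_distrib mult.commute)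
    have nonzero: "x \<noteq> 0" if "x ^ (2 ^ e - 1) = 1" for x :: 'a
      using that one_less_power[of "2::nat" e] e_pos by (auto simp: power_0_left)
    have "bij_betw (\<lambda>a. c * a) {a. a \<noteq> 0 \<and> u \<in> radical_units a} {x. x ^ (2 ^ e - 1) = 1}"
      by (rule bij_betw_byWitness[where f' = "\<lambda>x. x / c"])
        (simp_all add: c iff image_subset_iff nonzero del: One_nat_def)
    from bij_betw_same_card[OF this] show ?thesis
      by (simp only: card_roots_e)
  qed
  have "(\<Sum>a\<in>UNIV-{0}. card (radical_units a)) =
      (\<Sum>a\<in>UNIV-{0}. \<Sum>u\<in>UNIV-{0}. of_bool (u \<in> radical_units a))"
    using radical_units_nonzero
    by (intro sum.cong refl) (auto simp: of_bool_def sum.If_cases intro!: arg_cong[where f = card])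
  also have "\<dots> = (\<Sum>u\<in>UNIV-{0}. \<Sum>a\<in>UNIV-{0}. of_bool (u \<in> radical_units a))"
    by (rule sum.swap)
  also have "\<dots> = (\<Sum>u\<in>UNIV-{0}. card {a. a \<noteq> 0 \<and> u \<in> radical_units a})"
    by (intro sum.cong refl) (auto simp: of_bool_def sum.If_cases intro!: arg_cong[where f = card])
  also have "\<dots> = (\<Sum>u\<in>UNIV-{0::'a}. 3)"
    by (intro sum.cong refl fiber) simp
  finally show ?thesis
    by (simp add: card_Diff_singleton card_UNIV)
qed

lemma card_radical_zero: "card (radical 0) = 2 ^ m"
  by (simp add: radical_def card_UNIV)

lemma sum_card_radical_power:
  "5 * (\<Sum>a\<in>UNIV. int (card (radical a)) ^ j) = 5 * 2 ^ (m * j) + (2 ^ m - 1) * (4 + 16 ^ j)"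
proof -
  \<comment> \<open>With \<open>n = card (radical_units a)\<close> in \<open>{0, 15}\<close>, the
    power \<open>(1 + n) ^ j\<close> agrees with the linear interpolation between 1 and
    \<open>16 ^ j\<close>, so only the sum of the \<open>n\<close> is needed.\<close>
  have each: "15 * int (card (radical a)) ^ j = 15 + (16 ^ j - 1) * int (card (radical_units a))"
    if "a \<noteq> 0" for a
  proof -
    have "card (radical a) = Suc (card (radical_units a))"
      unfolding radical_eq[OF that] using radical_units_nonzero by (subst card_insert_disjoint) auto
    with card_radical_units[of a] show ?thesis
      by auto
  qed
  have "15 * (\<Sum>a\<in>UNIV-{0}. int (card (radical a)) ^ j) =
      (\<Sum>a\<in>UNIV-{0}. 15 + (16 ^ j - 1) * int (card (radical_units a)))"
    unfolding sum_distrib_left by (intro sum.cong refl each) simp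
  also have "\<dots> = 15 * int (card (UNIV - {0::'a}))
      + (16 ^ j - 1) * int (\<Sum>a\<in>UNIV-{0}. card (radical_units a))"
    by (simp add: sum.distrib sum_distrib_left)
  also have "\<dots> = 15 * (2 ^ m - 1) + (16 ^ j - 1) * (3 * (2 ^ m - 1))"
    unfolding sum_card_radical_units by (simp add: card_Diff_singleton card_UNIV of_nat_diff)
  finally have "5 * (\<Sum>a\<in>UNIV-{0}. int (card (radical a)) ^ j) = (2 ^ m - 1) * (4 + 16 ^ j)"
    by (simp add: algebra_simps)
  moreover have "(\<Sum>a\<in>UNIV. int (card (radical a)) ^ j) =
      2 ^ (m * j) + (\<Sum>a\<in>UNIV-{0}. int (card (radical a)) ^ j)"
    by (subst sum.remove[of _ 0]) (simp_all add: card_radical_zero power_mult)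
  ultimately show ?thesis
    by simp
qed

lemma odd_words_zero_sum_sets_eq:
  "5 * (\<Sum>T\<in>zero_sum_sets gold_fun. odd_words (2 ^ m) (2 * Suc j) (card T)) =
     2 ^ (m * j) * (5 * 2 ^ (m * j) + (2 ^ m - 1) * (4 + 16 ^ j))"
  unfolding odd_words_zero_sum_sets sum_card_radical_power[symmetric] by (simp add: mult_ac)

end

section \<open>Weight enumeration and affine invariance\<close>

text \<open>A word has no more odd letters than positions; this truncates each moment to weights at
  most its order.\<close>

lemma odd_words_eq_0: "k < t \<Longrightarrow> odd_words q k t = 0"
  by (induction k arbitrary: t) auto

context gold
begin

text \<open>For even \<open>k\<close> these model the codewords of weight \<open>k\<close>:
  membership of the point 0 is then fixed by the parity of the other points.\<close>

definition words :: "nat \<Rightarrow> 'a set set" where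
  "words k = {T \<in> zero_sum_sets gold_fun. card T = k}"

lemma sum_odd_words_by_weight:
  "(\<Sum>T\<in>zero_sum_sets gold_fun. odd_words q k (card T)) =
     (\<Sum>t\<le>k. int (card (words t)) * odd_words q k t)"
proof -
  have "(\<Sum>t\<le>k. int (card (words t)) * odd_words q k t) =
      (\<Sum>t\<le>k. \<Sum>T\<in>{T \<in> {T \<in> zero_sum_sets gold_fun. card T \<le> k}. card T = t}. odd_words q k (card T))"
  proof (rule sum.cong[OF refl])
    fix t
    assume "t \<in> {..k}"
    then have "{T \<in> {T \<in> zero_sum_sets gold_fun. card T \<le> k}. card T = t} = words t"
      by (auto simp: words_def)
    moreover have "(\<Sum>T\<in>words t. odd_words q k (card T)) = (\<Sum>T\<in>words t. odd_words q k t)"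
      by (rule sum.cong) (auto simp: words_def)
    ultimately show "int (card (words t)) * odd_words q k t =
        (\<Sum>T\<in>{T \<in> {T \<in> zero_sum_sets gold_fun. card T \<le> k}. card T = t}. odd_words q k (card T))"
      by simp
  qed
  also have "\<dots> = (\<Sum>T\<in>{T \<in> zero_sum_sets gold_fun. card T \<le> k}. odd_words q k (card T))"
    by (rule sum.group) auto
  also have "\<dots> = (\<Sum>T\<in>zero_sum_sets gold_fun. odd_words q k (card T))"
    by (rule sum.mono_neutral_left) (auto intro!: odd_words_eq_0)
  finally show ?thesis ..
qed

lemma card_words_0: "card (words 0) = 1"
proof -
  have "words 0 = {{}}"
    by (auto simp: words_def zero_sum_sets_def)
  then show ?thesis
    by simp
qed

lemma card_words_2: "card (words 2) = 0"
proof -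
  have "words 2 = {}"
  proof (rule equals0I)
    fix T
    assume "T \<in> words 2"
    then obtain x y where "T = {x, y}" "x \<noteq> y" "(\<Sum>z\<in>T. z) = 0"
      by (auto simp: words_def zero_sum_sets_def card_2_iff)
    then show False
      by (simp add: add_eq_0_iff_eq)
  qed
  then show ?thesis
    by simp
qed

text \<open>The system is triangular: odd weights have coefficient zero, and order
  \<open>2 * Suc j\<close> introduces the single new weight \<open>2 * Suc j\<close>, with
  coefficient its factorial.\<close>

lemma power_moments:
  "5 * (\<Sum>t\<le>2 * Suc j. int (card (words t)) * odd_words (2 ^ m) (2 * Suc j) t) =
     2 ^ (m * j) * (5 * 2 ^ (m * j) + (2 ^ m - 1) * (4 + 16 ^ j))"
  unfolding sum_odd_words_by_weight[symmetric] by (rule odd_words_zero_sum_sets_eq)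

lemma card_words_4: "12 * int (card (words 4)) = 2 ^ m * (2 ^ m - 1)"
proof -
  define q :: int where "q = 2 ^ m"
  \<comment> \<open>For \<open>t = 0\<close> every letter occurs evenly: \<open>q\<close> constant
    words and \<open>3 * q * (q - 1)\<close> words made of two distinct pairs.\<close>
  have w: "odd_words q 4 0 = 3 * q ^ 2 - 2 * q" "odd_words q 4 (Suc 0) = 0" "odd_words q 4 3 = 0"
    "odd_words q 4 4 = 24"
    by (simp_all add: eval_nat_numeral algebra_simps)
  have "5 * (\<Sum>t\<le>4. int (card (words t)) * odd_words q 4 t) = q * (5 * q + (q - 1) * 20)"
    using power_moments[of 1] by (simp add: q_def power_mult)
  moreover have "{..4::nat} = {0, 1, 2, 3, 4}"
    by auto
  ultimately show ?thesis
    by (simp add: w card_words_0 card_words_2 flip: q_def) (simp add: algebra_simps power2_eq_square)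
qed

lemma card_words_6:
  "720 * int (card (words 6)) = 2 ^ m * (2 ^ m - 1) * ((2 ^ m) ^ 2 + 8 * 2 ^ m + 96)"
proof -
  define q :: int where "q = 2 ^ m"
  define A4 where "A4 = int (card (words 4))"
  have w: "odd_words q 6 0 = 15 * q ^ 3 - 30 * q ^ 2 + 16 * q" "odd_words q 6 (Suc 0) = 0"
    "odd_words q 6 3 = 0" "odd_words q 6 4 = 360 * q - 960" "odd_words q 6 5 = 0"
    "odd_words q 6 6 = 720"
    by (simp_all add: eval_nat_numeral algebra_simps)
  have A4: "12 * A4 = q * (q - 1)"
    using card_words_4 by (simp add: A4_def q_def)
  \<comment> \<open>Here \<open>260 = 4 + 16 ^ 2\<close>.\<close>
  have "5 * (\<Sum>t\<le>6. int (card (words t)) * odd_words q 6 t) = q ^ 2 * (5 * q ^ 2 + (q - 1) * 260)"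
    using power_moments[of 2] by (simp add: q_def power_mult)
  moreover have "{..6::nat} = {0, 1, 2, 3, 4, 5, 6}"
    by auto
  ultimately have "5 * (15 * q ^ 3 - 30 * q ^ 2 + 16 * q + A4 * (360 * q - 960)
      + 720 * int (card (words 6))) = q ^ 2 * (5 * q ^ 2 + (q - 1) * 260)"
    by (simp add: w card_words_0 card_words_2 A4_def)
  with A4 have "720 * int (card (words 6)) = q * (q - 1) * (q ^ 2 + 8 * q + 96)"
    by algebra
  then show ?thesis
    by (simp add: q_def)
qed

lemma card_words_8:
  "40320 * int (card (words 8)) = 2 ^ m * (2 ^ m - 1) *
     ((2 ^ m) ^ 4 - 27 * (2 ^ m) ^ 3 + 184 * (2 ^ m) ^ 2 + 1044 * 2 ^ m + 6448)"
proof -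
  define q :: int where "q = 2 ^ m"
  define A4 where "A4 = int (card (words 4))"
  define A6 where "A6 = int (card (words 6))"
  have w: "odd_words q 8 0 = 105 * q ^ 4 - 420 * q ^ 3 + 588 * q ^ 2 - 272 * q"
    "odd_words q 8 (Suc 0) = 0" "odd_words q 8 3 = 0" "odd_words q 8 4 = 5040 * q ^ 2 - 30240 * q + 48384"
    "odd_words q 8 5 = 0" "odd_words q 8 6 = 20160 * q - 80640" "odd_words q 8 7 = 0"
    "odd_words q 8 8 = 40320"
    by (simp_all add: eval_nat_numeral algebra_simps)
  have A4: "12 * A4 = q * (q - 1)"
    using card_words_4 by (simp add: A4_def q_def)
  have A6: "720 * A6 = q * (q - 1) * (q ^ 2 + 8 * q + 96)"
    using card_words_6 by (simp add: A6_def q_def)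
  \<comment> \<open>Here \<open>4100 = 4 + 16 ^ 3\<close>.\<close>
  have "5 * (\<Sum>t\<le>8. int (card (words t)) * odd_words q 8 t) =
      q ^ 3 * (5 * q ^ 3 + (q - 1) * 4100)"
    using power_moments[of 3] by (simp add: q_def power_mult)
  moreover have "{..8::nat} = {0, 1, 2, 3, 4, 5, 6, 7, 8}"
    by auto
  ultimately have "5 * (105 * q ^ 4 - 420 * q ^ 3 + 588 * q ^ 2 - 272 * q
      + A4 * (5040 * q ^ 2 - 30240 * q + 48384) + A6 * (20160 * q - 80640)
      + 40320 * int (card (words 8))) = q ^ 3 * (5 * q ^ 3 + (q - 1) * 4100)"
    by (simp add: w card_words_0 card_words_2 A4_def A6_def)
  \<comment> \<open>The coefficients of \<open>A4\<close> and \<open>A6\<close> are multiples of 12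
    and 720, so both counts are eliminated without division.\<close>
  moreover have "A4 * (5040 * q ^ 2 - 30240 * q + 48384) = q * (q - 1) * (420 * q ^ 2 - 2520 * q + 4032)"
    unfolding A4[symmetric] by (simp add: algebra_simps)
  moreover have "A6 * (20160 * q - 80640) = q * (q - 1) * (q ^ 2 + 8 * q + 96) * (28 * q - 112)"
    unfolding A6[symmetric] by (simp add: algebra_simps)
  ultimately have "40320 * int (card (words 8)) = q ^ 3 * (q ^ 3 + (q - 1) * 820)
      - (105 * q ^ 4 - 420 * q ^ 3 + 588 * q ^ 2 - 272 * q)
      - q * (q - 1) * (420 * q ^ 2 - 2520 * q + 4032)
      - q * (q - 1) * (q ^ 2 + 8 * q + 96) * (28 * q - 112)"
    by (simp add: algebra_simps)
  also have "\<dots> = q * (q - 1) * (q ^ 4 - 27 * q ^ 3 + 184 * q ^ 2 + 1044 * q + 6448)"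
    by algebra
  finally have "40320 * int (card (words 8)) =
      q * (q - 1) * (q ^ 4 - 27 * q ^ 3 + 184 * q ^ 2 + 1044 * q + 6448)" .
  then show ?thesis
    by (simp add: q_def)
qed

section \<open>Affine invariance and words through a pair\<close>

lemma affine_image_words:
  assumes "T \<in> words k" and "even k" and "u \<noteq> 0"
  shows "(\<lambda>z. u * z + v) ` T \<in> words k"
proof -
  have inj: "inj_on (\<lambda>z. u * z + v) T"
    using assms(3) by (simp add: inj_on_def)
  have sums: "(\<Sum>z\<in>T. z) = 0" "(\<Sum>z\<in>T. gold_fun z) = 0" and k: "card T = k"
    using assms(1) by (simp_all add: words_def zero_sum_sets_def)
  \<comment> \<open>An even number of equal constants cancels, which removes all contributions of
    the translation alone.\<close>
  have "of_nat k = (0::'a)"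
    using assms(2) by (auto simp: two_eq_0)
  with k have const: "(\<Sum>z\<in>T. c) = 0" for c :: 'a
    by simp
  have frob: "(\<Sum>z\<in>T. z ^ (2 ^ e)) = 0"
    using frobenius_sum[of "\<lambda>z. z" T e] sums(1) by (simp add: power_0_left)
  have lin: "(\<Sum>z\<in>T. u * z + v) = 0"
    by (simp only: sum.distrib sum_distrib_left[symmetric] sums const mult_zero_right add_0_left)
  \<comment> \<open>The cross terms are multiples of \<open>z\<close> and
    \<open>z ^ (2 ^ e)\<close>; the latter also sums to zero, as a Frobenius image of the
    former.\<close>
  have "gold_fun (u * z + v) = gold_fun u * gold_fun z + gold_fun v
      + (u * v ^ (2 ^ e) * z + u ^ (2 ^ e) * v * z ^ (2 ^ e))" for z
    unfolding gold_fun_add by (simp add: gold_fun_def power_mult_distrib mult_ac)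
  then have "(\<Sum>z\<in>T. gold_fun (u * z + v)) = 0"
    by (simp only: sum.distrib sum_distrib_left[symmetric] sums const frob mult_zero_right
        add_0_left)
  with lin k show ?thesis
    by (simp add: words_def zero_sum_sets_def sum.reindex[OF inj] card_image[OF inj])
qed

text \<open>The affine map acts injectively on sets. An inequality suffices, since it can also be
  applied to the inverse map.\<close>

lemma card_words_through_affine_le:
  assumes "even k" and "u \<noteq> 0"
  shows "card {T \<in> words k. {x, y} \<subseteq> T} \<le> card {T \<in> words k. {u * x + v, u * y + v} \<subseteq> T}"
proof (rule card_inj_on_le)
  have "inj (\<lambda>z. u * z + v)"
    using assms(2) by (simp add: inj_on_def)
  then show "inj_on (image (\<lambda>z. u * z + v)) {T \<in> words k. {x, y} \<subseteq> T}"
    by (meson inj_on_image inj_on_subset subset_UNIV)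
  show "image (\<lambda>z. u * z + v) ` {T \<in> words k. {x, y} \<subseteq> T}
      \<subseteq> {T \<in> words k. {u * x + v, u * y + v} \<subseteq> T}"
    using affine_image_words[OF _ assms] by auto
qed simp

lemma card_words_through_eq:
  assumes "even k" and "x \<noteq> y"
  shows "card {T \<in> words k. {x, y} \<subseteq> T} = card {T \<in> words k. {0, 1} \<subseteq> T}"
proof (rule antisym)
  have d: "x + y \<noteq> 0"
    using assms(2) by (simp add: add_eq_0_iff_eq)
  \<comment> \<open>The map \<open>z \<mapsto> (z + x) / (x + y)\<close> sends \<open>x\<close> to 0
    and \<open>y\<close> to 1; its inverse \<open>z \<mapsto> (x + y) * z + x\<close> serves the
    other inequality.\<close>
  have "inverse (x + y) * y + inverse (x + y) * x = 1"
    unfolding distrib_left[symmetric] using d by (simp add: add.commute)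
  then show "card {T \<in> words k. {x, y} \<subseteq> T} \<le> card {T \<in> words k. {0, 1} \<subseteq> T}"
    using card_words_through_affine_le[OF assms(1), of "inverse (x + y)" x y "inverse (x + y) * x"] d
    by simp
  have "(x + y) * 1 + x = y"
    by (simp add: add.commute[of x y] add.assoc)
  then show "card {T \<in> words k. {0, 1} \<subseteq> T} \<le> card {T \<in> words k. {x, y} \<subseteq> T}"
    using card_words_through_affine_le[OF assms(1) d, of 0 1 x]
    by (simp only: mult_zero_right add_0_left)
qed

text \<open>Double counting of incidences: each word contains \<open>k * (k - 1)\<close> ordered
  pairs of distinct points, and all such pairs lie in equally many words.\<close>

lemma card_words_through_pair:
  assumes "even k" and "x \<noteq> y"
  shows "2 ^ m * (2 ^ m - 1) * card {T \<in> words k. {x, y} \<subseteq> T} = k * (k - 1) * card (words k)"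
proof -
  let ?P = "{p :: 'a \<times> 'a. fst p \<noteq> snd p}"
  have card_pairs: "card {p \<in> ?P. {fst p, snd p} \<subseteq> T} = card T * (card T - 1)" for T
  proof -
    have "{p \<in> ?P. {fst p, snd p} \<subseteq> T} = T \<times> T - (\<lambda>z. (z, z)) ` T"
      by auto
    also have "card \<dots> = card T * card T - card T"
      by (subst card_Diff_subset) (auto simp: card_cartesian_product card_image inj_on_def)
    finally show ?thesis
      by (simp add: diff_mult_distrib2)
  qed
  have "(\<Sum>p\<in>?P. card {T \<in> words k. {fst p, snd p} \<subseteq> T}) = (\<Sum>T\<in>words k. k * (k - 1))"
    by (rule sum_multicount_gen) (simp, simp, simp only: card_pairs, simp add: words_def)
  moreover have "(\<Sum>p\<in>?P. card {T \<in> words k. {fst p, snd p} \<subseteq> T}) =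
      (\<Sum>p\<in>?P. card {T \<in> words k. {x, y} \<subseteq> T})"
  proof (rule sum.cong[OF refl])
    fix p :: "'a \<times> 'a"
    assume "p \<in> ?P"
    then have "fst p \<noteq> snd p"
      by simp
    from card_words_through_eq[OF assms(1) this] card_words_through_eq[OF assms]
    show "card {T \<in> words k. {fst p, snd p} \<subseteq> T} = card {T \<in> words k. {x, y} \<subseteq> T}"
      by (rule trans[OF _ sym])
  qed
  ultimately have "(\<Sum>p\<in>?P. card {T \<in> words k. {x, y} \<subseteq> T}) = (\<Sum>T\<in>words k. k * (k - 1))"
    by (rule trans[OF sym, rotated])
  then show ?thesis
    using card_pairs[of UNIV] by (simp add: card_UNIV mult.commute)
qed

lemma card_words_8_through_pair:
  assumes "x \<noteq> y"
  shows "720 * int (card {T \<in> words 8. {x, y} \<subseteq> T}) =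
     (2 ^ m) ^ 4 - 27 * (2 ^ m) ^ 3 + 184 * (2 ^ m) ^ 2 + 1044 * 2 ^ m + 6448"
proof -
  define q :: int where "q = 2 ^ m"
  define l where "l = int (card {T \<in> words 8. {x, y} \<subseteq> T})"
  \<comment> \<open>Here \<open>56 = 8 * 7\<close>; the factor 720 in the claim is
    \<open>40320 / 56\<close>.\<close>
  have "int (2 ^ m * (2 ^ m - 1) * card {T \<in> words 8. {x, y} \<subseteq> T}) = int (56 * card (words 8))"
    using card_words_through_pair[OF _ assms, of 8] by simp
  then have "q * (q - 1) * l = 56 * int (card (words 8))"
    unfolding of_nat_mult by (simp add: q_def l_def of_nat_diff)
  moreover have "40320 * int (card (words 8)) =
      q * (q - 1) * (q ^ 4 - 27 * q ^ 3 + 184 * q ^ 2 + 1044 * q + 6448)"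
    using card_words_8 by (simp add: q_def)
  ultimately have "q * (q - 1) * (720 * l) =
      q * (q - 1) * (q ^ 4 - 27 * q ^ 3 + 184 * q ^ 2 + 1044 * q + 6448)"
    by algebra
  moreover have "q * (q - 1) \<noteq> 0"
    using m_pos by (auto simp: q_def)
  ultimately show ?thesis
    unfolding q_def[symmetric] l_def[symmetric] using mult_left_cancel by blast
qed

end

section \<open>Codewords as zero-sum sets\<close>

lemma sum_list_bit_eq_card_support: "sum_list c = of_nat (card (support c))" for c :: "bit list"
proof -
  have "sum_list c = (\<Sum>i<length c. c ! i)"
    by (simp add: sum_list_sum_nth atLeast0LessThan)
  also have "\<dots> = (\<Sum>i\<in>support c. 1)"
    by (rule sum.mono_neutral_cong_right) (auto simp: support_def)
  finally show ?thesis
    by simp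
qed

lemma of_nat_bit_eq_0_iff: "of_nat k = (0::bit) \<longleftrightarrow> even k"
  by (induction k) (auto simp del: add_bit_eq_xor)

section \<open>Evaluation of binary polynomials and minimal polynomials\<close>

context binary_field
begin

lemma of_bit_add: "(of_bit (a + b) :: 'a) = of_bit a + of_bit b"
  by (cases a; cases b) (simp_all add: two_eq_0)

lemma of_bit_mult: "(of_bit (a * b) :: 'a) = of_bit a * of_bit b"
  by (cases a; cases b) simp_all

lemma of_bit_sum: "(of_bit (sum f A) :: 'a) = (\<Sum>i\<in>A. of_bit (f i))"
proof (induction A rule: infinite_finite_induct)
  case (insert i A)
  show ?case
    by (simp only: sum.insert[OF insert.hyps] of_bit_add insert.IH)
qed simp_all

definition eval_bit :: "bit poly \<Rightarrow> 'a \<Rightarrow> 'a" where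
  "eval_bit p x = poly (map_poly of_bit p) x"

lemma eval_bit_0 [simp]: "eval_bit 0 x = 0"
  by (simp add: eval_bit_def)

lemma eval_bit_1 [simp]: "eval_bit 1 x = 1"
  by (simp add: eval_bit_def)

lemma eval_bit_add: "eval_bit (p + q) x = eval_bit p x + eval_bit q x"
proof -
  have "map_poly of_bit (p + q) = map_poly of_bit p + (map_poly of_bit q :: 'a poly)"
    by (rule poly_eqI) (simp add: coeff_map_poly of_bit_add del: add_bit_eq_xor)
  then show ?thesis
    by (simp add: eval_bit_def)
qed

lemma eval_bit_diff: "eval_bit (p - q) x = eval_bit p x + eval_bit q x"
  using eval_bit_add[of "p - q" q x] by (simp add: add.assoc)

lemma eval_bit_mult: "eval_bit (p * q) x = eval_bit p x * eval_bit q x"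
proof -
  have "map_poly of_bit (p * q) = map_poly of_bit p * (map_poly of_bit q :: 'a poly)"
  proof (rule poly_eqI)
    have zero: "of_bit 0 = (0::'a)"
      by simp
    show "coeff (map_poly of_bit (p * q)) n = coeff (map_poly of_bit p * (map_poly of_bit q :: 'a poly)) n"
      for n
      by (simp only: coeff_map_poly[where f = of_bit, OF zero] coeff_mult of_bit_sum of_bit_mult)
  qed
  then show ?thesis
    by (simp add: eval_bit_def)
qed

lemma eval_bit_monom: "eval_bit (monom 1 k) x = x ^ k"
  by (simp add: eval_bit_def map_poly_monom poly_monom)

lemma eval_bit_Poly: "eval_bit (Poly c) x = (\<Sum>i\<in>support c. x ^ i)"
proof -
  have "eval_bit (Poly c) x = (\<Sum>i<length c. of_bit (c ! i) * x ^ i)"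
  proof (induction c)
    case (Cons b c)
    have "eval_bit (Poly (b # c)) x = of_bit b + x * eval_bit (Poly c) x"
      by (simp add: eval_bit_def map_poly_pCons)
    then show ?case
      by (simp only: Cons.IH length_Cons sum.lessThan_Suc_shift nth_Cons_0 nth_Cons_Suc power_0
          power_Suc mult_1_right sum_distrib_left mult.left_commute)
  qed simp
  also have "\<dots> = (\<Sum>i\<in>support c. x ^ i)"
    by (rule sum.mono_neutral_cong_right) (auto simp: support_def)
  finally show ?thesis .
qed

text \<open>This justifies the definite description. A nonzero annihilator of least degree exists
  because \<open>x ^ (2 ^ m) - x\<close> vanishes everywhere; over two elements it is monic, and two
  such would differ by an annihilator of smaller degree.\<close>

lemma min_poly2_properties:
  "lead_coeff (min_poly2 x) = 1 \<and> eval_bit (min_poly2 x) x = 0 \<and>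
     (\<forall>q. q \<noteq> 0 \<and> eval_bit q x = 0 \<longrightarrow> degree (min_poly2 x) \<le> degree q)"
proof -
  let ?Z = "\<lambda>q. q \<noteq> 0 \<and> eval_bit q x = 0"
  let ?M = "\<lambda>p. lead_coeff p = 1 \<and> eval_bit p x = 0 \<and> (\<forall>q. ?Z q \<longrightarrow> degree p \<le> degree q)"
  \<comment> \<open>As \<open>2 ^ m \<noteq> 1\<close>, the linear term does not cancel.\<close>
  have "coeff (monom 1 (2 ^ m) - monom 1 1 :: bit poly) 1 = - 1"
    using m_pos by simp
  then have "monom 1 (2 ^ m) - monom 1 1 \<noteq> (0 :: bit poly)"
    by (metis coeff_0 bit_not_one_iff neg_equal_0_iff_equal zero_neq_one)
  then have "?Z (monom 1 (2 ^ m) - monom 1 1)"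
    by (simp add: eval_bit_diff eval_bit_monom power_card del: One_nat_def)
  then obtain p where p: "?Z p" and min: "\<And>q. ?Z q \<Longrightarrow> degree p \<le> degree q"
    using ex_has_least_nat[of ?Z _ degree] by blast
  have "lead_coeff p = 1"
    using p by (metis bit_not_zero_iff leading_coeff_0_iff)
  with p min have Mp: "?M p"
    by blast
  moreover have "p' = p" if Mp': "?M p'" for p'
  proof (rule ccontr)
    assume "p' \<noteq> p"
    have "p' \<noteq> 0"
      using Mp' by auto
    then have deg: "degree p' = degree p"
      using Mp' Mp p by (intro antisym) blast+
    have "coeff (p' - p) (degree p) = 0"
      using Mp' Mp deg by simp
    moreover have "degree (p' - p) \<le> degree p"
      using deg by (intro degree_diff_le) simp_all
    moreover have "?Z (p' - p)"
      using \<open>p' \<noteq> p\<close> Mp' Mp by (simp add: eval_bit_diff)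
    ultimately show False
      using min[of "p' - p"] by (metis antisym leading_coeff_0_iff)
  qed
  ultimately have "?M (THE p. ?M p)"
    by (rule theI)
  then show ?thesis
    unfolding min_poly2_def eval_bit_def by blast
qed

text \<open>The remainder on division by the minimal polynomial also vanishes at \<open>x\<close>
  but has smaller degree, so minimality makes it zero.\<close>

lemma min_poly2_dvd_iff: "min_poly2 x dvd p \<longleftrightarrow> eval_bit p x = 0"
proof
  assume "min_poly2 x dvd p"
  then show "eval_bit p x = 0"
    using min_poly2_properties[of x] by (auto simp: eval_bit_mult elim!: dvdE)
next
  assume "eval_bit p x = 0"
  moreover have "eval_bit p x = eval_bit (p div min_poly2 x * min_poly2 x + p mod min_poly2 x) x"
    by simp
  ultimately have r: "eval_bit (p mod min_poly2 x) x = 0"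
    using min_poly2_properties[of x] by (simp only: eval_bit_add eval_bit_mult) simp
  have "min_poly2 x \<noteq> 0"
    using min_poly2_properties[of x] by auto
  then have "p mod min_poly2 x = 0"
    using degree_mod_less[of "min_poly2 x" p] r min_poly2_properties[of x]
    by (meson linorder_not_less)
  then show "min_poly2 x dvd p"
    by (simp add: mod_eq_0_iff_dvd)
qed

text \<open>The modulus vanishes at \<open>x\<close> and \<open>y\<close>, so evaluation there
  respects the congruence. Conversely, vanishing at both makes the lcm divide the representing
  polynomial itself.\<close>

lemma mem_cyclic_code_lcm_iff:
  fixes x y :: 'a
  assumes "x ^ n = 1" and "y ^ n = 1"
  shows "c \<in> cyclic_code n (lcm (min_poly2 x) (min_poly2 y)) \<longleftrightarrow>
     length c = n \<and> (\<Sum>i\<in>support c. x ^ i) = 0 \<and> (\<Sum>i\<in>support c. y ^ i) = 0"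
proof -
  let ?g = "lcm (min_poly2 x) (min_poly2 y)"
  have "(\<exists>a. [Poly c = a * ?g] (mod (monom 1 n - 1))) \<longleftrightarrow> eval_bit (Poly c) x = 0 \<and> eval_bit (Poly c) y = 0"
  proof
    assume "\<exists>a. [Poly c = a * ?g] (mod (monom 1 n - 1))"
    then obtain a b where "Poly c - a * ?g = (monom 1 n - 1) * b"
      by (auto simp: cong_iff_dvd_diff elim!: dvdE)
    then have "Poly c = a * ?g + (monom 1 n - 1) * b"
      by (simp add: algebra_simps del: add_bit_eq_xor mult_bit_eq_and)
    moreover have "eval_bit ?g x = 0" "eval_bit ?g y = 0"
      by (simp_all add: min_poly2_dvd_iff[symmetric])
    ultimately show "eval_bit (Poly c) x = 0 \<and> eval_bit (Poly c) y = 0"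
      using assms by (simp add: eval_bit_add eval_bit_mult eval_bit_diff eval_bit_monom)
  next
    assume "eval_bit (Poly c) x = 0 \<and> eval_bit (Poly c) y = 0"
    then have "?g dvd Poly c"
      by (simp add: min_poly2_dvd_iff)
    then show "\<exists>a. [Poly c = a * ?g] (mod (monom 1 n - 1))"
      by (metis cong_refl dvd_def mult.commute)
  qed
  then show ?thesis
    by (simp add: cyclic_code_def eval_bit_Poly)
qed

text \<open>Cyclic coordinate \<open>i\<close> carries \<open>\<alpha> ^ i\<close>; the parity
  coordinate \<open>2 ^ m - 1\<close> carries the remaining point 0.\<close>

definition coord :: "nat \<Rightarrow> 'a" where
  "coord i = (if i < 2 ^ m - 1 then \<alpha> ^ i else 0)"

lemma bij_coord: "bij_betw coord {..<2 ^ m} UNIV"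
proof -
  have "bij_betw coord ({..<2 ^ m - 1} \<union> {2 ^ m - 1}) ((UNIV - {0}) \<union> {0})"
  proof (rule bij_betw_combine)
    show "bij_betw coord {..<2 ^ m - 1} (UNIV - {0})"
      using bij_\<alpha>_power by (rule bij_betw_cong[THEN iffD1, rotated]) (simp add: coord_def)
  qed (auto simp: bij_betw_def coord_def)
  moreover have "{..<2 ^ m - 1} \<union> {2 ^ m - 1} = {..<2 ^ m :: nat}"
    using card_minus_one_pos by (auto simp: less_Suc_eq)
  ultimately show ?thesis
    by simp
qed

end

section \<open>Transfer between codeword supports and point sets\<close>

context gold
begin

text \<open>The point 0 adds nothing to either sum, so the parity coordinate affects only the
  cardinality.\<close>

lemma image_coord_mem_words_iff:
  assumes "S \<subseteq> {..<2 ^ m}"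
  shows "coord ` S \<in> words k \<longleftrightarrow> card S = k \<and>
     (\<Sum>i\<in>S \<inter> {..<2 ^ m - 1}. \<alpha> ^ i) = 0 \<and>
     (\<Sum>i\<in>S \<inter> {..<2 ^ m - 1}. (\<alpha> ^ (1 + 2 ^ e)) ^ i) = 0"
proof -
  have inj: "inj_on coord S"
    using bij_betw_imp_inj_on[OF bij_coord] assms by (rule inj_on_subset)
  have fin: "finite S"
    using assms by (rule finite_subset) simp
  have "(\<Sum>i\<in>S. coord i) = (\<Sum>i\<in>S \<inter> {..<2 ^ m - 1}. \<alpha> ^ i)"
    by (rule sum.mono_neutral_cong_right) (auto simp: fin coord_def)
  moreover have "(\<Sum>i\<in>S. gold_fun (coord i)) = (\<Sum>i\<in>S \<inter> {..<2 ^ m - 1}. (\<alpha> ^ (1 + 2 ^ e)) ^ i)"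
  proof (rule sum.mono_neutral_cong_right)
    show "gold_fun (coord i) = (\<alpha> ^ (1 + 2 ^ e)) ^ i" if "i \<in> S \<inter> {..<2 ^ m - 1}" for i
    proof -
      have "coord i = \<alpha> ^ i"
        using that by (simp add: coord_def)
      then show ?thesis
        by (simp only: gold_fun_def power_mult[symmetric] mult.commute)
    qed
  qed (auto simp: fin coord_def gold_fun_def)
  ultimately show ?thesis
    by (simp add: words_def zero_sum_sets_def sum.reindex[OF inj] card_image[OF inj] conj_ac)
qed

lemma mem_code_iff:
  "c \<in> cyclic_code (2 ^ m - 1) (lcm (min_poly2 \<alpha>) (min_poly2 (\<alpha> ^ (1 + 2 ^ e)))) \<longleftrightarrow>
     length c = 2 ^ m - 1 \<and> (\<Sum>i\<in>support c. \<alpha> ^ i) = 0 \<and>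
     (\<Sum>i\<in>support c. (\<alpha> ^ (1 + 2 ^ e)) ^ i) = 0"
  by (rule mem_cyclic_code_lcm_iff)
    (rule power_card_minus_one, simp add: \<alpha>_nonzero)+

lemma supports_extended_code:
  assumes "even k"
  shows "{support c | c. c \<in> extended_code
       (cyclic_code (2 ^ m - 1) (lcm (min_poly2 \<alpha>) (min_poly2 (\<alpha> ^ (1 + 2 ^ e))))) \<and>
       hamming_weight c = k} =
     {S. S \<subseteq> {..<2 ^ m} \<and> coord ` S \<in> words k}" (is "?L = ?R")
proof -
  let ?n = "2 ^ m - 1 :: nat"
  have n: "Suc ?n = 2 ^ m"
    by simp
  have supp_app: "support (c @ [b]) \<inter> {..<length c} = support c" for c :: "bit list" and b
    by (auto simp: support_def nth_append)
  show ?thesis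
  proof (intro equalityI subsetI)
    fix S
    assume "S \<in> ?L"
    then obtain c where c: "length c = ?n" "(\<Sum>i\<in>support c. \<alpha> ^ i) = 0"
        "(\<Sum>i\<in>support c. (\<alpha> ^ (1 + 2 ^ e)) ^ i) = 0"
      and S: "S = support (c @ [sum_list c])" "card S = k"
      unfolding extended_code_def hamming_weight_def image_iff mem_Collect_eq
      using mem_code_iff by blast
    have sub: "S \<subseteq> {..<2 ^ m}"
      using c(1) n by (auto simp: S(1) support_def)
    have "S \<inter> {..<?n} = support c"
      using supp_app[of c] by (simp only: S(1) c(1))
    with c S(2) sub show "S \<in> ?R"
      by (simp only: mem_Collect_eq image_coord_mem_words_iff simp_thms)
  next
    fix S
    assume "S \<in> ?R"
    then have sub: "S \<subseteq> {..<2 ^ m}" and S: "card S = k"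
        "(\<Sum>i\<in>S \<inter> {..<?n}. \<alpha> ^ i) = 0" "(\<Sum>i\<in>S \<inter> {..<?n}. (\<alpha> ^ (1 + 2 ^ e)) ^ i) = 0"
      using image_coord_mem_words_iff by blast+
    \<comment> \<open>The codeword is recovered as the indicator vector of \<open>S\<close> on the
      cyclic coordinates.\<close>
    define c :: "bit list" where "c = map (\<lambda>i. of_bool (i \<in> S)) [0..<?n]"
    have len: "length c = ?n"
      by (simp add: c_def)
    have supp: "support c = S \<inter> {..<?n}"
      by (auto simp: support_def c_def)
    have mem: "c \<in> cyclic_code ?n (lcm (min_poly2 \<alpha>) (min_poly2 (\<alpha> ^ (1 + 2 ^ e))))"
      using S len by (simp only: mem_code_iff supp simp_thms)
    have fin: "finite S"
      using sub by (rule finite_subset) simp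
    have S_le: "i < ?n \<or> i = ?n" if "i \<in> S" for i
      using that sub n by (metis less_Suc_eq lessThan_iff subsetD)
    then have S_cases: "S = (if ?n \<in> S then insert ?n (S \<inter> {..<?n}) else S \<inter> {..<?n})"
      by auto
    have "card S = (if ?n \<in> S then Suc (card (S \<inter> {..<?n})) else card (S \<inter> {..<?n}))"
      by (subst S_cases) (simp add: fin)
    \<comment> \<open>As \<open>card S\<close> is even, the last index belongs to \<open>S\<close>
      exactly when the rest of \<open>S\<close> has odd size, that is, when the parity bit is
      1.\<close>
    then have last: "sum_list c \<noteq> 0 \<longleftrightarrow> ?n \<in> S"
      using assms S(1) unfolding sum_list_bit_eq_card_support of_nat_bit_eq_0_iff supp
      by (auto split: if_splits)
    have "i \<in> support (c @ [sum_list c]) \<longleftrightarrow> i \<in> S" for i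
    proof -
      consider "i < ?n" | "i = ?n" | "i > ?n"
        by linarith
      then show ?thesis
      proof cases
        case 1
        then show ?thesis
          using supp_app[of c "sum_list c"] supp len by auto
      next
        case 2
        then show ?thesis
          using last by (simp add: support_def len nth_append)
      next
        case 3
        then have "i \<notin> S"
          using S_le[of i] by auto
        then show ?thesis
          using 3 by (simp add: support_def len)
      qed
    qed
    then have "S = support (c @ [sum_list c])"
      by blast
    then show "S \<in> ?L"
      using mem S(1) unfolding extended_code_def hamming_weight_def by blast
  qed
qed

lemma two_design_words:
  assumes l: "\<And>x y. x \<noteq> y \<Longrightarrow> card {T \<in> words k. {x, y} \<subseteq> T} = l"
  shows "two_design {0..<2 ^ m} {S. S \<subseteq> {..<2 ^ m} \<and> coord ` S \<in> words k} (2 ^ m) k l"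
  unfolding two_design_def
proof (intro conjI ballI allI impI)
  fix S
  assume S: "S \<in> {S. S \<subseteq> {..<2 ^ m} \<and> coord ` S \<in> words k}"
  then show "S \<subseteq> {0..<2 ^ m}"
    by auto
  show "card S = k"
    using S image_coord_mem_words_iff by blast
next
  fix P :: "nat set"
  assume P: "P \<subseteq> {0..<2 ^ m} \<and> card P = 2"
  then obtain i j where ij: "P = {i, j}" "i \<noteq> j" "i < 2 ^ m" "j < 2 ^ m"
    by (auto simp: card_2_iff)
  have inj: "inj_on coord {..<2 ^ m}" and surj: "coord ` {..<2 ^ m} = UNIV"
    using bij_coord by (simp_all add: bij_betw_def)
  have neq: "coord i \<noteq> coord j"
    using inj_onD[OF inj] ij by auto
  let ?B = "{S \<in> {S. S \<subseteq> {..<2 ^ m} \<and> coord ` S \<in> words k}. P \<subseteq> S}"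
  have "card (image coord ` ?B) = card ?B"
    using inj by (intro card_image inj_onI) (metis (mono_tags, lifting) inj_on_image_eq_iff mem_Collect_eq)
  moreover have "image coord ` ?B = {T \<in> words k. {coord i, coord j} \<subseteq> T}"
  proof (intro equalityI subsetI)
    fix T
    assume T: "T \<in> {T \<in> words k. {coord i, coord j} \<subseteq> T}"
    \<comment> \<open>The preimage of \<open>T\<close> under the bijection \<open>coord\<close> is
      the block mapped onto \<open>T\<close>.\<close>
    let ?S = "{s. s < 2 ^ m \<and> coord s \<in> T}"
    have "coord ` ?S = T"
    proof -
      have "coord ` ?S = coord ` {..<2 ^ m} \<inter> T"
        by auto
      then show ?thesis
        by (simp add: surj)
    qed
    with T ij show "T \<in> image coord ` ?B"
      by (intro image_eqI[of _ _ ?S]) auto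
  qed (use ij in auto)
  ultimately show "card ?B = l"
    by (simp only: l[OF neq])
qed auto

end

section \<open>The design of weight 8 supports and its parameter\<close>

theorem theorem3p10:
  fixes \<alpha> :: "'a::{field,finite}" and m e :: nat and C_E :: "bit list set"
  assumes "m > 0" and "[m = 0] (mod 4)"
    and "2 \<le> e" and "e \<le> m div 2" and "gcd m e = 2"
    and "CARD('a) = 2 ^ m"
    and "range (\<lambda>i::nat. \<alpha> ^ i) = UNIV - {0}"
    and "C_E = cyclic_code (2 ^ m - 1) (lcm (min_poly2 \<alpha>) (min_poly2 (\<alpha> ^ (1 + 2 ^ e))))"
  shows "\<exists>l::nat.
      real l = (2 ^ (4 * m - 4) - 27 * 2 ^ (3 * m - 4) + 23 * 2 ^ (2 * m - 1)
                 + 261 * 2 ^ (m - 2) + 403) / 45 \<and>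
      two_design {0..<2 ^ m} {support c | c. c \<in> extended_code C_E \<and> hamming_weight c = 8}
        (2 ^ m) 8 l"
proof -
  have four: "4 dvd m"
    using assms(2) by (simp add: cong_0_iff)
  interpret gold m \<alpha> e
    by unfold_locales (use assms four in auto)
  \<comment> \<open>The pair of 0 and 1 stands for all pairs, by double transitivity of the affine
    group.\<close>
  define l where "l = card {T \<in> words 8. {0, 1} \<subseteq> T}"
  have "two_design {0..<2 ^ m} {S. S \<subseteq> {..<2 ^ m} \<and> coord ` S \<in> words 8} (2 ^ m) 8 l"
    unfolding l_def by (intro two_design_words card_words_through_eq) simp_all
  then have design:
    "two_design {0..<2 ^ m} {support c | c. c \<in> extended_code C_E \<and> hamming_weight c = 8} (2 ^ m) 8 l"
    unfolding assms(8) by (subst supports_extended_code) simp_all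
  define q :: real where "q = 2 ^ m"
  have "real_of_int (720 * int l) =
      real_of_int ((2 ^ m) ^ 4 - 27 * (2 ^ m) ^ 3 + 184 * (2 ^ m) ^ 2 + 1044 * 2 ^ m + 6448)"
    unfolding l_def by (subst card_words_8_through_pair) simp_all
  then have l: "720 * real l = q ^ 4 - 27 * q ^ 3 + 184 * q ^ 2 + 1044 * q + 6448"
    by (simp add: q_def)
  \<comment> \<open>This makes every natural-number subtraction in the exponents exact.\<close>
  have m: "m \<ge> 4"
    using four assms(1) by (simp add: dvd_imp_le)
  \<comment> \<open>Since \<open>720 = 16 * 45\<close>, dividing by 16 gives the stated
    coefficients: \<open>184 / 16 = 23 / 2\<close>, \<open>1044 / 16 = 261 / 4\<close> and
    \<open>6448 / 16 = 403\<close>.\<close>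
  have "(2::real) ^ (4 * m - 4) = q ^ 4 / 16" "(2::real) ^ (3 * m - 4) = q ^ 3 / 16"
    "(2::real) ^ (2 * m - 1) = q ^ 2 / 2" "(2::real) ^ (m - 2) = q / 4"
    using m by (simp_all add: q_def power_diff power_mult[symmetric] mult.commute)
  with l have "real l = (2 ^ (4 * m - 4) - 27 * 2 ^ (3 * m - 4) + 23 * 2 ^ (2 * m - 1)
      + 261 * 2 ^ (m - 2) + 403) / 45"
    by simp
  with design show ?thesis
    by blast
qed

end
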